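(* Let $n\ge1$. For any opener-closer configuration $(\mathcal O,\mathcal C)$ of type $C_n$ there exist a unique non-crossing set partition $\mathcal B$ of type $C_n$ and a unique non-nesting set partition $\mathcal B'$ of type $C_n$ such that $$\operatorname{op}(\mathcal B)=\operatorname{op}(\mathcal B')=\mathcal O\quad\text{and}\quad \operatorname{cl}(\mathcal B)=\operatorname{cl}(\mathcal B')=\mathcal C.$$
   Context: Let $[n]=\{1,\dots,n\}$ (with $[0]=\emptyset$) and $[\pm n]=\{1,\dots,n,-1,\dots,-n\}$. A set partition of type $C_n$ is a set partition $\mathcal B$ of $[\pm n]$ such that $B\in\mathcal B\Leftrightarrow -B\in\mathcal B$ and such that there is at most one block $B_0\in\mathcal B$ (the zero block) with $B_0=-B_0$. The nesting order on $[\pm n]$ is $1<2<\dots<n<-n<\dots<-2<-1$; the crossing order is $1<2<\dots<n<-1<-2<\dots<-n$. The arcs of $\mathcal B$ are the pairs $(i,j)$ where $i$ and $j$ lie in the same block, $i$ precedes $j$ in the nesting order, and $i,j$ are consecutive elements of that block with respect to the nesting order. A crossing is an unordered pair of arcs whose endpoint sets can be written $\{a,b\}$, $\{a',b'\}$ with $a<a'<b<b'$ in the crossing order. A nesting is an unordered pair of arcs whose endpoint sets can be written $\{a,b\}$, $\{a',b'\}$ with $a<a'<b'<b$ in the nesting order. A set partition of type $C_n$ is non-crossing (non-nesting) if it has no crossings (no nestings). The openers $\operatorname{op}(\mathcal B)$ are the positive elements of $[\pm n]$ that are not maximal in their block with respect to the nesting order; the closers $\operatorname{cl}(\mathcal B)$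 are the positive elements that are not minimal in their block with respect to the nesting order. An opener-closer configuration of type $C_n$ is a pair $(\mathcal O,\mathcal C)$ of subsets $\mathcal O,\mathcal C\subseteq[n]$ with $|\mathcal O\cap[k]|\ge|\mathcal C\cap[k+1]|$ for all $k\in\{0,1,\dots,n-1\}$ (it is not required that $|\mathcal O|=|\mathcal C|$). *)

theory Defs
  imports "HOL-Library.Disjoint_Sets"
begin

definition pm_set :: "nat \<Rightarrow> int set" where
  "pm_set n = {1..int n} \<union> uminus ` {1..int n}"

(* There is no zero in pm_set n; on the nonzero integers both orders below are strict linear
   orders, and their restrictions to pm_set n are the two orders of type C_n.
   Nesting order:  1 < 2 < ... < n < -n < ... < -2 < -1.
   Crossing order: 1 < 2 < ... < n < -1 < -2 < ... < -n. *)

definition nest_less :: "int \<Rightarrow> int \<Rightarrow> bool" where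
  "nest_less i j \<longleftrightarrow> (0 < i \<and> j < 0) \<or> (0 < i \<and> 0 < j \<and> i < j) \<or> (i < 0 \<and> j < 0 \<and> i < j)"

definition cross_less :: "int \<Rightarrow> int \<Rightarrow> bool" where
  "cross_less i j \<longleftrightarrow> (0 < i \<and> j < 0) \<or> (0 < i \<and> 0 < j \<and> i < j) \<or> (i < 0 \<and> j < 0 \<and> j < i)"

definition type_C_partition :: "nat \<Rightarrow> int set set \<Rightarrow> bool" where
  "type_C_partition n P \<longleftrightarrow>
     partition_on (pm_set n) P \<and>
     (\<forall>B. B \<in> P \<longleftrightarrow> uminus ` B \<in> P) \<and>
     (\<exists>\<^sub>\<le>\<^sub>1 B. B \<in> P \<and> B = uminus ` B)"

definition arcs :: "int set set \<Rightarrow> (int \<times> int) set" where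
  "arcs P = {(i, j). \<exists>B\<in>P. i \<in> B \<and> j \<in> B \<and> nest_less i j \<and>
                       \<not> (\<exists>k\<in>B. nest_less i k \<and> nest_less k j)}"

(* Arcs are oriented by the nesting order, so a crossing may read an arc (i, j) against its
   orientation; hence the comparison of unoriented endpoint sets. *)
definition crossings :: "int set set \<Rightarrow> (int \<times> int) set set" where
  "crossings P = {{(i, j), (i', j')} | i j i' j'. (i, j) \<in> arcs P \<and> (i', j') \<in> arcs P \<and>
     (\<exists>a b a' b'. {i, j} = {a, b} \<and> {i', j'} = {a', b'} \<and>
        cross_less a a' \<and> cross_less a' b \<and> cross_less b b')}"

definition nestings :: "int set set \<Rightarrow> (int \<times> int) set set" where
  "nestings P = {{(i, j), (i', j')} | i j i' j'. (i, j) \<in> arcs P \<and> (i', j') \<in> arcs P \<and>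
     (\<exists>a b a' b'. {i, j} = {a, b} \<and> {i', j'} = {a', b'} \<and>
        nest_less a a' \<and> nest_less a' b' \<and> nest_less b' b)}"

definition noncrossing :: "int set set \<Rightarrow> bool" where
  "noncrossing P \<longleftrightarrow> crossings P = {}"

definition nonnesting :: "int set set \<Rightarrow> bool" where
  "nonnesting P \<longleftrightarrow> nestings P = {}"

definition openers :: "int set set \<Rightarrow> int set" where
  "openers P = {i. 0 < i \<and> (\<exists>B\<in>P. i \<in> B \<and> (\<exists>j\<in>B. nest_less i j))}"

definition closers :: "int set set \<Rightarrow> int set" where
  "closers P = {i. 0 < i \<and> (\<exists>B\<in>P. i \<in> B \<and> (\<exists>j\<in>B. nest_less j i))}"

definition opener_closer_config :: "nat \<Rightarrow> int set \<Rightarrow> int set \<Rightarrow> bool" where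
  "opener_closer_config n Op Cl \<longleftrightarrow>
     Op \<subseteq> {1..int n} \<and> Cl \<subseteq> {1..int n} \<and>
     (\<forall>k<n. card (Op \<inter> {1..int k}) \<ge> card (Cl \<inter> {1..int (k + 1)}))"

end

theory Submission
  imports Defs
begin

text \<open>
  A partition of type \<open>C\<^sub>n\<close> is the same thing as its arcs: a family of pairs increasing in the
  nesting order, with at most one arc leaving and at most one arc entering each element, and
  stable under \<open>(i, j) \<mapsto> (-j, -i)\<close>. Under this symmetry every arc is, up to its mirror image,
  either positive, that is \<open>(i, j)\<close> with \<open>0 < i < j\<close>, or of the form \<open>(i, -k)\<close> with
  \<open>i, k > 0\<close>. The positive arcs match every closer with an earlier opener. The openers left over
  are exactly the elements \<open>i\<close> with an arc \<open>(i, -k)\<close>, and \<open>i \<mapsto> k\<close> is an involution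
  of this set.

  Two arcs \<open>(i, -k)\<close> and \<open>(i', -k')\<close> with \<open>i < i'\<close> cross in the crossing order iff
  \<open>k < k'\<close>, and they nest in the nesting order iff \<open>k < k'\<close>. Hence in both cases the
  involution must be the order reversal, and this one also allows at most one zero block, because a
  zero block contains an arc \<open>(i, -i)\<close> and the reversal has at most one fixed point. As for the
  positive arcs, read the closers from left to right. If a closer \<open>j\<close> takes an opener \<open>i\<close>
  while another opener \<open>x < j\<close> is still free, then the arc that \<open>x\<close> obtains later goes
  beyond \<open>j\<close>; it crosses \<open>(i, j)\<close> iff \<open>x > i\<close>, and \<open>(i, j)\<close> is nested in it
  iff \<open>x < i\<close>. So a partition whose involution is the order reversal is
  non-crossing iff each closer takes the largest free opener, and non-nesting iff each closer takes
  the smallest one (lemmas \<open>noncrossing_iff_greedy_Max\<close> and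
  \<open>nonnesting_iff_greedy_Min\<close>).

  Existence and uniqueness can therefore be proved once, for an arbitrary rule \<open>sel\<close> that selects
  an element of the set of free openers (lemma \<open>unique_greedy_partition\<close>): the rule determines the
  matching, and the inequalities of an opener-closer configuration say that a free opener is always
  there when a closer needs one.
\<close>

section \<open>A partition and its arcs determine each other\<close>

lemma nest_less_trans: "nest_less i j \<Longrightarrow> nest_less j k \<Longrightarrow> nest_less i k"
  by (auto simp: nest_less_def)

lemma nest_less_irrefl: "\<not> nest_less i i"
  by (auto simp: nest_less_def)

lemma nest_less_linear: "i \<noteq> 0 \<Longrightarrow> j \<noteq> 0 \<Longrightarrow> nest_less i j \<or> i = j \<or> nest_less j i"
  by (auto simp: nest_less_def)

lemma nest_less_uminus: "nest_less (- j) (- i) \<longleftrightarrow> nest_less i j"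
  by (auto simp: nest_less_def)

lemma nest_less_pos: "nest_less i j \<Longrightarrow> 0 < j \<Longrightarrow> 0 < i \<and> i < j"
  by (auto simp: nest_less_def)

lemma mem_pm_set: "i \<in> pm_set n \<longleftrightarrow> i \<noteq> 0 \<and> \<bar>i\<bar> \<le> int n"
proof
  assume i: "i \<noteq> 0 \<and> \<bar>i\<bar> \<le> int n"
  show "i \<in> pm_set n"
  proof (cases "0 < i")
    case True
    then show ?thesis using i by (auto simp: pm_set_def)
  next
    case False
    then have "- i \<in> {1..int n}" "i = - (- i)" using i by auto
    then show ?thesis unfolding pm_set_def by blast
  qed
qed (auto simp: pm_set_def)

lemma finite_pm_set: "finite (pm_set n)"
  by (simp add: pm_set_def)

text \<open>
  Connectedness by arcs. Along a block the arcs form a single increasing path, so following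
  arcs in one direction, from one or the other of the two elements, is enough.
\<close>
definition chain_rel :: "int set \<Rightarrow> (int \<times> int) set \<Rightarrow> (int \<times> int) set" where
  "chain_rel S A = {(x, y). x \<in> S \<and> y \<in> S \<and> ((x, y) \<in> A\<^sup>* \<or> (y, x) \<in> A\<^sup>*)}"

text \<open>
  Between two elements of a finite block that are not joined by an arc lies a third one, so a
  path of arcs is found by induction on the number of elements in between.
\<close>
lemma arcs_trancl_if_same_block:
  assumes "B \<in> P" "finite B" "i \<in> B" "j \<in> B" "nest_less i j"
  shows "(i, j) \<in> (arcs P)\<^sup>+"
  using assms(3-5)
proof (induction "card {k \<in> B. nest_less i k \<and> nest_less k j}" arbitrary: i j rule: less_induct)
  case less
  show ?case
  proof (cases "\<exists>k\<in>B. nest_less i k \<and> nest_less k j")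
    case False
    then show ?thesis using less.prems \<open>B \<in> P\<close> unfolding arcs_def by blast
  next
    case True
    then obtain k where k: "k \<in> B" "nest_less i k" "nest_less k j" by blast
    have "{l \<in> B. nest_less i l \<and> nest_less l k} \<subset> {l \<in> B. nest_less i l \<and> nest_less l j}"
      "{l \<in> B. nest_less k l \<and> nest_less l j} \<subset> {l \<in> B. nest_less i l \<and> nest_less l j}"
      using k nest_less_trans nest_less_irrefl by blast+
    then have "(i, k) \<in> (arcs P)\<^sup>+" "(k, j) \<in> (arcs P)\<^sup>+"
      using less.hyps less.prems k \<open>finite B\<close> by (simp_all add: psubset_card_mono)
    then show ?thesis by (rule trancl_trans)
  qed
qed

lemma same_block_if_arcs_rtrancl:
  assumes "partition_on S P" "(i, j) \<in> (arcs P)\<^sup>*" "B \<in> P" "i \<in> B"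
  shows "j \<in> B"
  using assms(2)
proof (induction rule: rtrancl_induct)
  case (step y z)
  then obtain B' where "B' \<in> P" "y \<in> B'" "z \<in> B'" unfolding arcs_def by blast
  then show ?case
    using step.IH assms(1,3) by (metis disjointD partition_onD2 IntI empty_iff)
qed (use assms in simp)

text \<open>
  This recovers a partition from its arcs, and thus reduces uniqueness of the partition to
  uniqueness of its arcs.
\<close>
lemma partition_eq_quotient_arcs:
  assumes P: "partition_on S P" and "finite S" "0 \<notin> S"
  shows "P = S // chain_rel S (arcs P)"
proof -
  have "{(x, y). \<exists>B\<in>P. x \<in> B \<and> y \<in> B} = chain_rel S (arcs P)" (is "?E = _")
  proof (intro set_eqI iffI; clarify)
    fix x y B assume B: "B \<in> P" "x \<in> B" "y \<in> B"
    then have S: "x \<in> S" "y \<in> S" "finite B"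
      using P \<open>finite S\<close> by (auto simp: partition_on_def intro: finite_subset)
    then have "nest_less x y \<or> x = y \<or> nest_less y x"
      using \<open>0 \<notin> S\<close> nest_less_linear by metis
    then show "(x, y) \<in> chain_rel S (arcs P)"
      using S B arcs_trancl_if_same_block[of B P] by (auto simp: chain_rel_def trancl_into_rtrancl)
  next
    fix x y assume xy: "(x, y) \<in> chain_rel S (arcs P)"
    then obtain B B' where "B \<in> P" "x \<in> B" "B' \<in> P" "y \<in> B'"
      using P by (auto simp: chain_rel_def partition_on_def)
    then show "\<exists>B\<in>P. x \<in> B \<and> y \<in> B"
      using xy same_block_if_arcs_rtrancl[OF P] by (auto simp: chain_rel_def)
  qed
  then show ?thesis using partition_on_eq_quotient[OF P] by simp
qed

lemma type_C_partition_eqI: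
  assumes "type_C_partition n P" "type_C_partition n Q" "arcs P = arcs Q"
  shows "P = Q"
proof -
  have "0 \<notin> pm_set n" by (simp add: mem_pm_set)
  then show ?thesis
    using assms partition_eq_quotient_arcs[OF _ finite_pm_set] unfolding type_C_partition_def by metis
qed

lemma openers_eq_Domain_arcs:
  assumes "type_C_partition n P"
  shows "openers P = {i \<in> Domain (arcs P). 0 < i}"
proof (intro set_eqI iffI)
  fix i assume "i \<in> openers P"
  then obtain B j where B: "0 < i" "B \<in> P" "i \<in> B" "j \<in> B" "nest_less i j"
    unfolding openers_def by blast
  then have "finite B" using assms finite_pm_set
    by (auto simp: type_C_partition_def partition_on_def intro: finite_subset)
  from arcs_trancl_if_same_block[OF B(2) this B(3-5)] show "i \<in> {i \<in> Domain (arcs P). 0 < i}"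
    using B(1) by (auto dest: tranclD)
qed (auto simp: openers_def arcs_def)

lemma closers_eq_Range_arcs:
  assumes "type_C_partition n P"
  shows "closers P = {j \<in> Range (arcs P). 0 < j}"
proof (intro set_eqI iffI)
  fix j assume "j \<in> closers P"
  then obtain B i where B: "0 < j" "B \<in> P" "i \<in> B" "j \<in> B" "nest_less i j"
    unfolding closers_def by blast
  then have "finite B" using assms finite_pm_set
    by (auto simp: type_C_partition_def partition_on_def intro: finite_subset)
  from arcs_trancl_if_same_block[OF B(2) this B(3-5)] show "j \<in> {j \<in> Range (arcs P). 0 < j}"
    using B(1) by (auto dest: tranclD2)
qed (auto simp: closers_def arcs_def)

text \<open>
  An intrinsic description of the families of arcs that come from a partition invariant under
  negation; uniqueness of the zero block is not part of it, and will follow from order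
  reversal.
\<close>
definition type_C_arcs :: "nat \<Rightarrow> (int \<times> int) set \<Rightarrow> bool" where
  "type_C_arcs n A \<longleftrightarrow> A \<subseteq> pm_set n \<times> pm_set n \<and> (\<forall>(i, j)\<in>A. nest_less i j) \<and>
     single_valued A \<and> single_valued (A\<inverse>) \<and> (\<forall>(i, j)\<in>A. (- j, - i) \<in> A)"

lemma type_C_arcsD:
  assumes "type_C_arcs n A"
  shows "(i, j) \<in> A \<Longrightarrow> i \<in> pm_set n" "(i, j) \<in> A \<Longrightarrow> j \<in> pm_set n"
    "(i, j) \<in> A \<Longrightarrow> nest_less i j"
    "(i, j) \<in> A \<Longrightarrow> (i, j') \<in> A \<Longrightarrow> j = j'"
    "(i, j) \<in> A \<Longrightarrow> (i', j) \<in> A \<Longrightarrow> i = i'"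
    "(- j, - i) \<in> A \<longleftrightarrow> (i, j) \<in> A"
proof -
  show "(- j, - i) \<in> A \<longleftrightarrow> (i, j) \<in> A"
    using assms unfolding type_C_arcs_def by (metis (no_types, lifting) add.inverse_inverse case_prodD)
qed (use assms in \<open>auto simp: type_C_arcs_def single_valued_def\<close>)

lemma type_C_arcs_arcs:
  assumes "type_C_partition n P"
  shows "type_C_arcs n (arcs P)"
proof -
  have P: "partition_on (pm_set n) P" using assms by (simp add: type_C_partition_def)
  have same: "B = B'" if "B \<in> P" "B' \<in> P" "x \<in> B" "x \<in> B'" for B B' x
    using that partition_onD2[OF P] by (metis disjointD IntI empty_iff)
  have sub: "B \<subseteq> pm_set n" if "B \<in> P" for B using that P by (auto simp: partition_on_def)
  have lin: "nest_less x y \<or> x = y \<or> nest_less y x" if "B \<in> P" "x \<in> B" "y \<in> B" for B x y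
    using nest_less_linear[of x y] subsetD[OF sub[OF that(1)] that(2)]
      subsetD[OF sub[OF that(1)] that(3)] by (simp add: mem_pm_set)
  have "single_valued (arcs P)" "single_valued ((arcs P)\<inverse>)"
    unfolding single_valued_def arcs_def using same lin by blast+
  moreover have "(- j, - i) \<in> arcs P" if "(i, j) \<in> arcs P" for i j
  proof -
    from that obtain B where B: "B \<in> P" "i \<in> B" "j \<in> B" "nest_less i j"
      "\<And>k. k \<in> B \<Longrightarrow> \<not> (nest_less i k \<and> nest_less k j)" unfolding arcs_def by blast
    have "uminus ` B \<in> P" using assms B(1) by (auto simp: type_C_partition_def)
    moreover have "\<not> (nest_less (- j) k \<and> nest_less k (- i))" if "k \<in> uminus ` B" for k
      using that B(5) by (auto simp: nest_less_uminus)
    ultimately show ?thesis using B(2-4) nest_less_uminus unfolding arcs_def by blast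
  qed
  moreover have "i \<in> pm_set n \<and> j \<in> pm_set n \<and> nest_less i j" if "(i, j) \<in> arcs P" for i j
    using that sub unfolding arcs_def by blast
  ultimately show ?thesis unfolding type_C_arcs_def by auto
qed

lemma rtrancl_imp_nest_le:
  assumes "type_C_arcs n A" "(x, y) \<in> A\<^sup>*"
  shows "x = y \<or> nest_less x y"
  using assms(2)
proof (induction rule: rtrancl_induct)
  case (step y z)
  then show ?case using type_C_arcsD(3)[OF assms(1) step.hyps(2)] nest_less_trans by blast
qed simp

lemma rtrancl_uminus:
  assumes "type_C_arcs n A" "(x, y) \<in> A\<^sup>*"
  shows "(- y, - x) \<in> A\<^sup>*"
  using assms(2)
proof (induction rule: rtrancl_induct)
  case (step y z)
  have "(- z, - y) \<in> A" using type_C_arcsD(6)[OF assms(1)] step.hyps(2) by blast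
  then show ?case using step.IH by (rule converse_rtrancl_into_rtrancl)
qed simp

text \<open>
  Two paths that leave the same element, or that end in the same element, are comparable
  because the arcs are single-valued in both directions; this gives transitivity.
\<close>
lemma equiv_chain_rel:
  assumes A: "type_C_arcs n A"
  shows "equiv (pm_set n) (chain_rel (pm_set n) A)"
proof (rule equivI)
  have sv: "single_valued A" "single_valued (A\<inverse>)" using A by (auto simp: type_C_arcs_def)
  have "(y, z) \<in> A\<^sup>* \<or> (z, y) \<in> A\<^sup>*" if "(y, x) \<in> A\<^sup>*" "(z, x) \<in> A\<^sup>*" for x y z
    using single_valued_confluent[OF sv(2)] that by (simp add: rtrancl_converse)
  then show "trans (chain_rel (pm_set n) A)"
    using single_valued_confluent[OF sv(1)] unfolding trans_def chain_rel_def
    by (simp, blast intro: rtrancl_trans)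
qed (auto simp: chain_rel_def refl_on_def sym_def)

text \<open>
  An element strictly between \<open>i\<close> and \<open>j\<close> in the class of
  \<open>i\<close> would have to lie on the path starting in \<open>i\<close>, but the first
  step of this path already leads to \<open>j\<close> if \<open>(i, j)\<close> is an arc. So no
  arc is lost or gained by passing to classes.
\<close>
lemma arcs_chain_quotient:
  assumes A: "type_C_arcs n A"
  shows "arcs (pm_set n // chain_rel (pm_set n) A) = A" (is "arcs ?P = _")
proof (intro set_eqI iffI; clarify)
  note D = type_C_arcsD[OF A] and less = rtrancl_imp_nest_le[OF A]
  note E = equiv_chain_rel[OF A]
  {
    fix i j assume "(i, j) \<in> arcs ?P"
    then obtain B where B: "B \<in> ?P" "i \<in> B" "j \<in> B" "nest_less i j"
      "\<And>k. k \<in> B \<Longrightarrow> \<not> (nest_less i k \<and> nest_less k j)" unfolding arcs_def by blast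
    have "(i, j) \<in> chain_rel (pm_set n) A" using B E by (meson quotient_eqI in_quotient_imp_in_rel empty_subsetI insert_subset)
    then have "(i, j) \<in> A\<^sup>*"
      using B(4) less nest_less_trans nest_less_irrefl unfolding chain_rel_def by blast
    then obtain k where k: "(i, k) \<in> A" "(k, j) \<in> A\<^sup>*"
      using B(4) nest_less_irrefl by (metis converse_rtranclE)
    have "(i, k) \<in> chain_rel (pm_set n) A" using k(1) D by (auto simp: chain_rel_def)
    then have "k \<in> B" using B E by (meson in_quotient_imp_closed)
    then show "(i, j) \<in> A" using B(5) k D(3) less by blast
  next
    fix i j assume ij: "(i, j) \<in> A"
    let ?B = "chain_rel (pm_set n) A `` {i}"
    have B: "?B \<in> ?P" using D(1)[OF ij] by (rule quotientI)
    have "i \<in> ?B" "j \<in> ?B" using ij D by (auto simp: chain_rel_def)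
    moreover have "\<not> (nest_less i k \<and> nest_less k j)" if "k \<in> ?B" for k
    proof
      assume k: "nest_less i k \<and> nest_less k j"
      have "(i, k) \<in> A\<^sup>*" using that k less nest_less_trans nest_less_irrefl
        unfolding chain_rel_def by blast
      then obtain i' where i': "(i, i') \<in> A" "(i', k) \<in> A\<^sup>*"
        using k nest_less_irrefl by (metis converse_rtranclE)
      then have "i' = j" using D(4) ij by blast
      then show False using i' k less nest_less_trans nest_less_irrefl by blast
    qed
    ultimately show "(i, j) \<in> arcs ?P" using B D(3)[OF ij] unfolding arcs_def by blast
  }
qed

text \<open>
  In a block stable under negation, the numerically largest element \<open>b\<close> is the
  last positive one in the nesting order, and \<open>-b\<close> is the first negative one.
\<close>
lemma zero_block_arc:
  assumes P: "partition_on (pm_set n) P" and B: "B \<in> P" "B = uminus ` B"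
  shows "\<exists>b\<in>B. 0 < b \<and> (b, - b) \<in> arcs P"
proof -
  let ?b = "Max B"
  have sub: "B \<subseteq> pm_set n" "B \<noteq> {}" using P B by (auto simp: partition_on_def)
  have fin: "finite B" using sub finite_pm_set finite_subset by blast
  have neg: "- x \<in> B" if "x \<in> B" for x using that B(2) by blast
  have b: "?b \<in> B" using fin sub by simp
  have le: "x \<le> ?b" if "x \<in> B" for x using fin that by simp
  have "?b \<noteq> 0" using b sub by (auto simp: mem_pm_set)
  then have pos: "0 < ?b" using le[OF neg[OF b]] by linarith
  have "\<not> (nest_less ?b k \<and> nest_less k (- ?b))" if "k \<in> B" for k
    using le[OF that] le[OF neg[OF that]] pos by (auto simp: nest_less_def)
  moreover have "nest_less ?b (- ?b)" using pos by (simp add: nest_less_def)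
  ultimately show ?thesis using b neg[OF b] pos B(1) unfolding arcs_def by blast
qed

text \<open>
  The negative end points are negated because the arcs are invariant under
  \<open>(i, j) \<mapsto> (-j, -i)\<close>: this makes the relation symmetric, and \<open>(b, b)\<close> in it
  marks a zero block.
\<close>
definition through :: "(int \<times> int) set \<Rightarrow> (int \<times> int) set" where
  "through A = {(i, k). 0 < i \<and> 0 < k \<and> (i, - k) \<in> A}"

definition antitone :: "(int \<times> int) set \<Rightarrow> bool" where
  "antitone G \<longleftrightarrow> (\<forall>(i, k)\<in>G. \<forall>(i', k')\<in>G. i < i' \<longrightarrow> k' < k)"

lemma antitoneD: "antitone G \<Longrightarrow> (i, k) \<in> G \<Longrightarrow> (i', k') \<in> G \<Longrightarrow> i < i' \<Longrightarrow> k' < k"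
  by (auto simp: antitone_def)

text \<open>
  Antitonicity enters through the zero block: two zero blocks would give two fixed points of
  the relation \<open>through A\<close>, which an order-reversing relation cannot have.
\<close>
lemma ex_type_C_partition_with_arcs:
  assumes A: "type_C_arcs n A" and anti: "antitone (through A)"
  shows "\<exists>P. type_C_partition n P \<and> arcs P = A"
proof -
  let ?E = "chain_rel (pm_set n) A"
  let ?P = "pm_set n // ?E"
  note E = equiv_chain_rel[OF A]
  have part: "partition_on (pm_set n) ?P" using E by (rule partition_on_quotient)
  have arcs: "arcs ?P = A" by (rule arcs_chain_quotient[OF A])
  have E_neg: "(- x, - y) \<in> ?E" if "(x, y) \<in> ?E" for x y
    using that rtrancl_uminus[OF A] by (auto simp: chain_rel_def mem_pm_set)
  have neg: "uminus ` B \<in> ?P" if "B \<in> ?P" for B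
  proof -
    from that obtain x where x: "x \<in> pm_set n" "B = ?E `` {x}" by (auto elim: quotientE)
    have "uminus ` B = ?E `` {- x}"
    proof (intro set_eqI iffI)
      fix y assume "y \<in> ?E `` {- x}"
      then have "- y \<in> B" using E_neg[of "- x" y] x by simp
      then show "y \<in> uminus ` B" by force
    qed (use x E_neg in auto)
    moreover have "- x \<in> pm_set n" using x by (simp add: mem_pm_set)
    ultimately show ?thesis by (simp add: quotientI)
  qed
  have "B = B'" if B: "B \<in> ?P \<and> B = uminus ` B" "B' \<in> ?P \<and> B' = uminus ` B'" for B B'
  proof -
    obtain b where b: "b \<in> B" "0 < b" "(b, - b) \<in> A"
      using zero_block_arc[OF part] B(1) arcs by metis
    obtain b' where b': "b' \<in> B'" "0 < b'" "(b', - b') \<in> A"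
      using zero_block_arc[OF part] B(2) arcs by metis
    have "(b, b) \<in> through A" "(b', b') \<in> through A" using b b' by (auto simp: through_def)
    then have "b = b'" using antitoneD[OF anti] by (metis linorder_neqE not_less_iff_gr_or_eq)
    then show ?thesis
      using b(1) b'(1) B partition_onD2[OF part] by (metis disjointD IntI empty_iff)
  qed
  then have "\<exists>\<^sub>\<le>\<^sub>1 B. B \<in> ?P \<and> B = uminus ` B" by (auto intro!: Uniq_I)
  moreover have "B \<in> ?P" if "uminus ` B \<in> ?P" for B
    using neg[OF that] by (simp add: image_image)
  ultimately have "type_C_partition n ?P" unfolding type_C_partition_def using part neg by blast
  then show ?thesis using arcs by blast
qed


section \<open>Order-reversing matchings of a finite set\<close>

text \<open>
  The only order-reversing matching of a finite set with itself: an element with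
  \<open>m\<close> elements below it is matched with the one that has \<open>m\<close> elements
  above it.
\<close>
definition reversal :: "int set \<Rightarrow> (int \<times> int) set" where
  "reversal R = {(i, k). i \<in> R \<and> k \<in> R \<and> card (R \<inter> {..<i}) = card (R \<inter> {k<..})}"

lemma card_below_mono:
  fixes i k :: int
  assumes "finite R" "i \<in> R" "i < k"
  shows "card (R \<inter> {..<i}) < card (R \<inter> {..<k})"
  using assms by (intro psubset_card_mono) auto

lemma card_above_antimono:
  fixes i k :: int
  assumes "finite R" "k \<in> R" "i < k"
  shows "card (R \<inter> {k<..}) < card (R \<inter> {i<..})"
  using assms by (intro psubset_card_mono) auto

lemma card_below_above:
  fixes i :: int
  assumes "finite R" "i \<in> R"
  shows "card (R \<inter> {..<i}) + card (R \<inter> {i<..}) + 1 = card R"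
proof -
  have "R = insert i (R \<inter> {..<i} \<union> R \<inter> {i<..})" using assms(2) by auto
  then have "card R = Suc (card (R \<inter> {..<i} \<union> R \<inter> {i<..}))"
    using assms(1) by (metis (no_types, lifting) IntE UnE card_insert_disjoint finite_Int finite_Un
        greaterThan_iff less_irrefl lessThan_iff)
  also have "card (R \<inter> {..<i} \<union> R \<inter> {i<..}) = card (R \<inter> {..<i}) + card (R \<inter> {i<..})"
    using assms(1) by (intro card_Un_disjoint) auto
  finally show ?thesis by simp
qed

lemma sym_reversal: "finite R \<Longrightarrow> (i, k) \<in> reversal R \<Longrightarrow> (k, i) \<in> reversal R"
  using card_below_above[of R i] card_below_above[of R k] by (simp add: reversal_def)

lemma antitone_reversal:
  assumes "finite R"
  shows "antitone (reversal R)"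
  unfolding antitone_def
proof clarify
  fix i k i' k' assume h: "(i, k) \<in> reversal R" "(i', k') \<in> reversal R" "i < i'"
  then have less: "card (R \<inter> {k<..}) < card (R \<inter> {k'<..})"
    using card_below_mono[of R i i'] assms by (simp add: reversal_def)
  show "k' < k"
  proof (rule ccontr)
    assume "\<not> k' < k"
    then have "R \<inter> {k'<..} \<subseteq> R \<inter> {k<..}" by auto
    then show False using less assms by (meson card_mono finite_Int leD)
  qed
qed

lemma single_valued_reversal:
  assumes "finite R" "(i, k) \<in> reversal R" "(i, k') \<in> reversal R"
  shows "k = k'"
proof (rule ccontr)
  assume "k \<noteq> k'"
  then consider "k < k'" | "k' < k" by linarith
  then show False
    using assms card_above_antimono[of R k' k] card_above_antimono[of R k k']
    by cases (auto simp: reversal_def)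
qed

text \<open>
  Counting the elements above \<open>k\<close> is an injection of \<open>R\<close> into the
  numbers below \<open>card R\<close>, hence a bijection.
\<close>
lemma reversal_total:
  assumes R: "finite R" and i: "i \<in> R"
  shows "\<exists>k. (i, k) \<in> reversal R"
proof -
  let ?f = "\<lambda>k. card (R \<inter> {k<..})"
  have "inj_on ?f R"
  proof (rule inj_onI)
    fix x y assume "x \<in> R" "y \<in> R" "?f x = ?f y"
    then show "x = y" using card_above_antimono[OF R, of x y] card_above_antimono[OF R, of y x]
      by (metis less_irrefl linorder_neqE)
  qed
  moreover have "?f ` R \<subseteq> {..<card R}" using card_below_above[OF R] by fastforce
  ultimately have "?f ` R = {..<card R}" by (simp add: card_image card_subset_eq)
  moreover have "card (R \<inter> {..<i}) < card R" using card_below_above[OF R i] by simp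
  ultimately obtain k where "k \<in> R" "card (R \<inter> {..<i}) = ?f k" by blast
  then show ?thesis using i by (auto simp: reversal_def)
qed

text \<open>
  An order-reversing matching that sends \<open>i\<close> to \<open>k\<close> restricts to a
  bijection from the elements below \<open>i\<close> to those above \<open>k\<close>.
\<close>
lemma antitone_matching_eq_reversal:
  assumes R: "finite R" and G: "Domain G = R" "Range G = R" "single_valued G" and anti: "antitone G"
  shows "G = reversal R"
proof -
  have sub: "G \<subseteq> reversal R"
  proof clarify
    fix i k assume ik: "(i, k) \<in> G"
    have "bij_betw (\<lambda>x. THE y. (x, y) \<in> G) (R \<inter> {..<i}) (R \<inter> {k<..})"
    proof -
      let ?g = "\<lambda>x. THE y. (x, y) \<in> G"
      have g: "?g x = y" if "(x, y) \<in> G" for x y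
        using that G(3) by (auto simp: single_valued_def)
      have gG: "(x, ?g x) \<in> G" if "x \<in> R" for x
        using that g G(1) by (metis DomainE)
      have "inj_on ?g R"
        using gG antitoneD[OF anti] by (intro inj_onI) (metis less_irrefl linorder_neqE)
      moreover have "?g ` (R \<inter> {..<i}) = R \<inter> {k<..}"
      proof (intro set_eqI iffI)
        fix y assume "y \<in> ?g ` (R \<inter> {..<i})"
        then obtain x where x: "x \<in> R" "x < i" "y = ?g x" by blast
        then show "y \<in> R \<inter> {k<..}" using gG[of x] antitoneD[OF anti _ ik] G(2) by blast
      next
        fix y assume y: "y \<in> R \<inter> {k<..}"
        then obtain x where x: "(x, y) \<in> G" using G(2) by blast
        have "x \<noteq> i" using x ik y G(3) by (auto simp: single_valued_def)
        then have "x < i" using antitoneD[OF anti ik x] y by fastforce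
        moreover have "x \<in> R" using x G(1) by blast
        moreover have "y = ?g x" using g[OF x] by simp
        ultimately show "y \<in> ?g ` (R \<inter> {..<i})" by blast
      qed
      ultimately show ?thesis by (auto simp: bij_betw_def intro: inj_on_subset)
    qed
    from bij_betw_same_card[OF this] show "(i, k) \<in> reversal R"
      using ik G(1,2) unfolding reversal_def by blast
  qed
  moreover have "reversal R \<subseteq> G"
  proof clarify
    fix i k assume ik: "(i, k) \<in> reversal R"
    then obtain k' where "(i, k') \<in> G" using G(1) by (auto simp: reversal_def)
    then show "(i, k) \<in> G" using sub single_valued_reversal[OF R ik] by blast
  qed
  ultimately show ?thesis by blast
qed

section \<open>Greedy families of arcs\<close>

text \<open>
  The openers that are free when the closers are processed in increasing order and the turn of
  \<open>j\<close> has come.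
\<close>
definition available :: "(int \<times> int) set \<Rightarrow> int \<Rightarrow> int set" where
  "available A j = {i \<in> Domain A. 0 < i \<and> i < j \<and> \<not> (\<exists>j'. 0 < j' \<and> j' < j \<and> (i, j') \<in> A)}"

text \<open>
  The choice rule \<open>sel\<close> is the only difference between the non-crossing and the non-nesting
  case; antitonicity is what both of them demand of the arcs from positive to negative elements.
\<close>
definition greedy :: "(int set \<Rightarrow> int) \<Rightarrow> (int \<times> int) set \<Rightarrow> bool" where
  "greedy sel A \<longleftrightarrow> (\<forall>(i, j)\<in>A. 0 < j \<longrightarrow> i = sel (available A j)) \<and> antitone (through A)"

lemma greedyD: "greedy sel A \<Longrightarrow> (i, j) \<in> A \<Longrightarrow> 0 < j \<Longrightarrow> i = sel (available A j)"
  by (auto simp: greedy_def)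

lemma greedy_antitone: "greedy sel A \<Longrightarrow> antitone (through A)"
  by (simp add: greedy_def)

lemma mem_available_if_arc:
  assumes A: "type_C_arcs n A" and ij: "(i, j) \<in> A" "0 < j"
  shows "i \<in> available A j"
proof -
  have "0 < i" "i < j" using nest_less_pos[OF type_C_arcsD(3)[OF A ij(1)] ij(2)] by simp_all
  moreover have "j' = j" if "(i, j') \<in> A" for j' using type_C_arcsD(4)[OF A that ij(1)] .
  ultimately show ?thesis using ij(1) unfolding available_def by blast
qed

lemma finite_available: "finite (available A j)"
  by (rule finite_subset[of _ "{0<..<j}"]) (auto simp: available_def)

text \<open>
  By induction on \<open>j\<close>: the openers available to \<open>j\<close> depend only on
  the arcs into smaller closers, and the rule selects the same one among them.
\<close>
lemma positive_arcs_eq: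
  assumes A: "type_C_arcs n A" and A': "type_C_arcs n A'"
    and ops: "{i \<in> Domain A. 0 < i} = {i \<in> Domain A'. 0 < i}"
    and cls: "{j \<in> Range A. 0 < j} = {j \<in> Range A'. 0 < j}"
    and gr: "greedy sel A" and gr': "greedy sel A'"
    and "0 < j"
  shows "(i, j) \<in> A \<longleftrightarrow> (i, j) \<in> A'"
  using \<open>0 < j\<close>
proof (induction "nat j" arbitrary: i j rule: less_induct)
  case less
  have "(x, j') \<in> A \<longleftrightarrow> (x, j') \<in> A'" if "0 < j'" "j' < j" for x j'
    using less.hyps[of j'] that by simp
  then have av: "available A j = available A' j"
    using ops unfolding available_def by blast
  have "j \<in> Range A \<longleftrightarrow> j \<in> Range A'" using cls less.prems by blast
  then show ?case
    using greedyD[OF gr _ less.prems] greedyD[OF gr' _ less.prems] av by (metis Range.simps)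
qed

text \<open>
  The openers that take part in an arc \<open>(i, -k)\<close> are those without a positive arc,
  so the positive arcs determine these arcs as well.
\<close>
lemma through_eq_reversal:
  assumes A: "type_C_arcs n A" and anti: "antitone (through A)"
  shows "through A = reversal {i \<in> Domain A. 0 < i \<and> \<not> (\<exists>j>0. (i, j) \<in> A)}" (is "_ = reversal ?R")
proof (rule antitone_matching_eq_reversal)
  note D = type_C_arcsD[OF A]
  have "?R \<subseteq> pm_set n" using D(1) by blast
  then show "finite ?R" using finite_pm_set finite_subset by blast
  show dom: "Domain (through A) = ?R"
  proof (intro set_eqI iffI)
    fix i assume "i \<in> ?R"
    then obtain j where j: "(i, j) \<in> A" "\<not> 0 < j" "0 < i" by blast
    then have "j < 0" using D(2) by (metis linorder_neqE mem_pm_set)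
    then have "(i, - j) \<in> through A" using j by (simp add: through_def)
    then show "i \<in> Domain (through A)" by blast
  next
    fix i assume "i \<in> Domain (through A)"
    then obtain k where k: "(i, - k) \<in> A" "0 < i" "0 < k" by (auto simp: through_def)
    have "\<not> (\<exists>j>0. (i, j) \<in> A)" using D(4)[OF k(1)] k(3) by fastforce
    then show "i \<in> ?R" using k by blast
  qed
  have sym: "(k, i) \<in> through A" if "(i, k) \<in> through A" for i k
    using that D(6)[of "- k" i] by (simp add: through_def)
  then show "Range (through A) = ?R" using dom by blast
  show "single_valued (through A)"
    by (rule single_valuedI) (auto simp: through_def dest: D(4))
qed (rule anti)

lemma greedy_arcs_unique:
  assumes A: "type_C_arcs n A" and A': "type_C_arcs n A'"
    and ops: "{i \<in> Domain A. 0 < i} = {i \<in> Domain A'. 0 < i}"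
    and cls: "{j \<in> Range A. 0 < j} = {j \<in> Range A'. 0 < j}"
    and gr: "greedy sel A" and gr': "greedy sel A'"
  shows "A = A'"
proof -
  note pos = positive_arcs_eq[OF assms]
  have "{i \<in> Domain A. 0 < i \<and> \<not> (\<exists>j>0. (i, j) \<in> A)} = {i \<in> Domain A'. 0 < i \<and> \<not> (\<exists>j>0. (i, j) \<in> A')}"
    using pos ops by blast
  then have "through A = through A'"
    using through_eq_reversal[OF A greedy_antitone[OF gr]]
      through_eq_reversal[OF A' greedy_antitone[OF gr']] by simp
  then have thr: "(i, - k) \<in> A \<longleftrightarrow> (i, - k) \<in> A'" if "0 < i" "0 < k" for i k
    using that by (auto simp: through_def set_eq_iff)
  have "(i, j) \<in> A \<longleftrightarrow> (i, j) \<in> A'" if nz: "i \<noteq> 0" "j \<noteq> 0" for i j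
  proof -
    consider "0 < j" | "j < 0" "0 < i" | "i < 0" using nz by linarith
    then show ?thesis
    proof cases
      case 2
      then show ?thesis using thr[of i "- j"] by simp
    next
      case 3
      then show ?thesis
        using pos[of "- i" "- j"] type_C_arcsD(6)[OF A] type_C_arcsD(6)[OF A'] by simp
    qed (rule pos)
  qed
  moreover have "i \<noteq> 0 \<and> j \<noteq> 0" if "(i, j) \<in> A \<union> A'" for i j
    using that type_C_arcsD(1,2)[OF A, of i j] type_C_arcsD(1,2)[OF A', of i j]
    by (auto simp: mem_pm_set)
  ultimately show ?thesis by (metis UnCI subsetI subset_antisym surj_pair)
qed

text \<open>
  The closers up to \<open>m\<close> are served one after the other. When \<open>m + 1\<close>
  is a closer, fewer than \<open>card (Cl \<inter> {1..m + 1})\<close> openers are used up, and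
  by the configuration inequality at least so many lie in \<open>{1..m}\<close>, so one of them
  is free. Serving \<open>m + 1\<close> does not disturb the choices made for smaller closers,
  since these only look at arcs further to the left.
\<close>
lemma greedy_matching_exists:
  fixes sel :: "int set \<Rightarrow> int"
  assumes sel: "\<And>S. finite S \<Longrightarrow> S \<noteq> {} \<Longrightarrow> sel S \<in> S"
    and Op: "finite Op"
    and cfg: "\<And>k. k < n \<Longrightarrow> card (Cl \<inter> {1..int (k + 1)}) \<le> card (Op \<inter> {1..int k})"
    and Op_pos: "\<And>i. i \<in> Op \<Longrightarrow> 0 < i"
    and "m \<le> n"
  shows "\<exists>M. Domain M \<subseteq> Op \<and> Range M = Cl \<inter> {1..int m} \<and> single_valued M \<and> single_valued (M\<inverse>) \<and>
    (\<forall>i j. (i, j) \<in> M \<longrightarrow> i < j \<and> i = sel {x \<in> Op. x < j \<and> \<not> (\<exists>j'<j. (x, j') \<in> M)})"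
  using \<open>m \<le> n\<close>
proof (induction m)
  case 0
  show ?case by (rule exI[of _ "{}"]) auto
next
  case (Suc m)
  from Suc.IH[OF Suc_leD[OF Suc.prems]]
  obtain M where M: "Domain M \<subseteq> Op" "Range M = Cl \<inter> {1..int m}"
      "single_valued M" "single_valued (M\<inverse>)"
    and less: "\<And>i j. (i, j) \<in> M \<Longrightarrow> i < j"
    and greedy: "\<And>i j. (i, j) \<in> M \<Longrightarrow> i = sel {x \<in> Op. x < j \<and> \<not> (\<exists>j'<j. (x, j') \<in> M)}"
    by blast
  let ?j = "int (Suc m)"
  have step: "{1..?j} = insert ?j {1..int m}" by auto
  show ?case
  proof (cases "?j \<in> Cl")
    case False
    then have "Cl \<inter> {1..?j} = Cl \<inter> {1..int m}" using step by auto
    then show ?thesis using M less greedy by (intro exI[of _ M] conjI) simp_all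
  next
    case True
    let ?S = "{x \<in> Op. x < ?j \<and> \<not> (\<exists>j'<?j. (x, j') \<in> M)}"
    let ?i = "sel ?S"
    have le: "j \<le> int m" if "(i, j) \<in> M" for i j using that M(2) by auto
    \<comment> \<open>Otherwise all openers up to \<open>m\<close> would be matched with the closers up to \<open>m\<close>.\<close>
    have "?S \<noteq> {}"
    proof
      assume "?S = {}"
      then have sub: "Op \<inter> {1..int m} \<subseteq> Domain M" by fastforce
      have bij: "bij_betw (\<lambda>j. THE i. (i, j) \<in> M) (Range M) (Domain M)"
      proof (rule bij_betw_byWitness[where f' = "\<lambda>i. THE j. (i, j) \<in> M"])
        have 1: "(THE i. (i, j) \<in> M) = i" "(THE j. (i, j) \<in> M) = j" if "(i, j) \<in> M" for i j
          using that M(3,4) by (auto simp: single_valued_def)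
        show "\<forall>j\<in>Range M. (THE j'. (THE i. (i, j) \<in> M, j') \<in> M) = j"
          "\<forall>i\<in>Domain M. (THE i'. (i', THE j. (i, j) \<in> M) \<in> M) = i"
          using 1 by auto
        show "(\<lambda>j. THE i. (i, j) \<in> M) ` Range M \<subseteq> Domain M"
          "(\<lambda>i. THE j. (i, j) \<in> M) ` Domain M \<subseteq> Range M"
          using 1 by auto
      qed
      have "card (Op \<inter> {1..int m}) \<le> card (Domain M)"
        using sub finite_subset[OF M(1) Op] by (rule card_mono[rotated])
      also have "\<dots> = card (Cl \<inter> {1..int m})" using bij_betw_same_card[OF bij] M(2) by simp
      also have "\<dots> < card (Cl \<inter> {1..?j})" using True step by simp
      also have "\<dots> \<le> card (Op \<inter> {1..int m})" using cfg[of m] Suc.prems by simp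
      finally show False by simp
    qed
    then have i: "?i \<in> ?S" using sel[of ?S] Op by simp
    then have new: "?i \<notin> Domain M" using le by fastforce
    let ?M = "insert (?i, ?j) M"
    have jnew: "?j \<notin> Range M" using le by fastforce
    have same: "{x \<in> Op. x < j \<and> \<not> (\<exists>j'<j. (x, j') \<in> ?M)} = {x \<in> Op. x < j \<and> \<not> (\<exists>j'<j. (x, j') \<in> M)}"
      if "j \<le> ?j" for j using that by auto
    show ?thesis
    proof (intro exI[of _ ?M] conjI)
      show "Domain ?M \<subseteq> Op" using M(1) i by auto
      show "Range ?M = Cl \<inter> {1..?j}" using M(2) True step by auto
      show "single_valued ?M" using M(3) new by (auto simp: single_valued_def)
      show "single_valued (?M\<inverse>)" using M(4) jnew by (auto simp: single_valued_def)
      show "\<forall>i j. (i, j) \<in> ?M \<longrightarrow> i < j \<and> i = sel {x \<in> Op. x < j \<and> \<not> (\<exists>j'<j. (x, j') \<in> ?M)}"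
      proof (intro allI impI)
        fix x j assume xj: "(x, j) \<in> ?M"
        then have "j \<le> ?j" using le by fastforce
        then show "x < j \<and> x = sel {x \<in> Op. x < j \<and> \<not> (\<exists>j'<j. (x, j') \<in> ?M)}"
          unfolding same[OF \<open>j \<le> ?j\<close>] using xj i less greedy by blast
      qed
    qed
  qed
qed

text \<open>
  The greedy matching of the closers, its mirror image under negation, and the order reversal
  of the unmatched openers together form the required arcs.
\<close>
lemma greedy_arcs_exist:
  fixes sel :: "int set \<Rightarrow> int"
  assumes sel: "\<And>S. finite S \<Longrightarrow> S \<noteq> {} \<Longrightarrow> sel S \<in> S"
    and cfg: "opener_closer_config n Op Cl"
  shows "\<exists>A. type_C_arcs n A \<and> greedy sel A \<and>
    {i \<in> Domain A. 0 < i} = Op \<and> {j \<in> Range A. 0 < j} = Cl"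
proof -
  have Op: "finite Op" "\<And>i. i \<in> Op \<Longrightarrow> 0 < i \<and> i \<le> int n"
    and Cl: "\<And>j. j \<in> Cl \<Longrightarrow> 0 < j \<and> j \<le> int n" "Cl \<inter> {1..int n} = Cl"
    using cfg by (auto simp: opener_closer_config_def intro: finite_subset)
  have le: "\<And>k. k < n \<Longrightarrow> card (Cl \<inter> {1..int (k + 1)}) \<le> card (Op \<inter> {1..int k})"
    using cfg by (simp add: opener_closer_config_def)
  obtain M where M: "Domain M \<subseteq> Op" "Range M = Cl" "single_valued M" "single_valued (M\<inverse>)"
    and MM: "\<forall>i j. (i, j) \<in> M \<longrightarrow> i < j \<and> i = sel {x \<in> Op. x < j \<and> \<not> (\<exists>j'<j. (x, j') \<in> M)}"
    using greedy_matching_exists[of sel Op n Cl n, OF sel Op(1) le _ order_refl] Op(2)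
    unfolding Cl(2) by blast
  have less: "i < j" and gr: "i = sel {x \<in> Op. x < j \<and> \<not> (\<exists>j'<j. (x, j') \<in> M)}"
    if "(i, j) \<in> M" for i j using MM that by blast+
  have Mpos: "i \<in> Op" "j \<in> Cl" "0 < i" "0 < j" "i \<le> int n" "j \<le> int n" if "(i, j) \<in> M" for i j
    using that M(1,2) Op(2) Cl(1) by blast+
  define R where "R = Op - Domain M"
  have R: "finite R" "\<And>i. i \<in> R \<Longrightarrow> 0 < i \<and> i \<le> int n" using Op by (auto simp: R_def)
  have rev: "i \<in> R" "k \<in> R" if "(i, k) \<in> reversal R" for i k
    using that by (auto simp: reversal_def)
  define A where "A = {(i, j). (i, j) \<in> M \<or> (- j, - i) \<in> M \<or> (i, - j) \<in> reversal R}"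
  have Apos: "(i, j) \<in> A \<longleftrightarrow> (i, j) \<in> M" if "0 < j" for i j
    using that Mpos(4)[of "- j" "- i"] Mpos(3)[of "- j" "- i"] rev(2)[of i "- j"] R(2)[of "- j"]
    by (auto simp: A_def)
  have Athr: "(i, - k) \<in> A \<longleftrightarrow> (i, k) \<in> reversal R" if "0 < i" "0 < k" for i k
    using that Mpos(4)[of i "- k"] Mpos(4)[of k "- i"] by (auto simp: A_def)
  have neg: "(- j, - i) \<in> A" if "(i, j) \<in> A" for i j
    using that sym_reversal[OF R(1), of i "- j"] by (auto simp: A_def)
  have nz: "i \<in> pm_set n \<and> j \<in> pm_set n" if "(i, j) \<in> A" for i j
    using that Mpos[of i j] Mpos[of "- j" "- i"] rev[of i "- j"] R(2)[of i] R(2)[of "- j"]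
    by (auto simp: A_def mem_pm_set)
  have nest: "nest_less i j" if "(i, j) \<in> A" for i j
    using that Mpos[of i j] Mpos[of "- j" "- i"] less[of i j] less[of "- j" "- i"]
      rev[of i "- j"] R(2)[of i] R(2)[of "- j"]
    by (auto simp: A_def nest_less_def)
  have sv: "single_valued A"
  proof (rule single_valuedI)
    fix i j j' assume ij: "(i, j) \<in> A" "(i, j') \<in> A"
    have notR: "i \<notin> R" if "(i, l) \<in> M" for l using that by (auto simp: R_def)
    show "j = j'"
    proof (cases "0 < i")
      case True
      then have "(- l, - i) \<notin> M" for l using Mpos(4)[of "- l" "- i"] by auto
      then have *: "(i, l) \<in> A \<longleftrightarrow> (i, l) \<in> M \<or> (i, - l) \<in> reversal R" for l
        by (simp add: A_def)
      show ?thesis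
        using ij[unfolded *] notR rev(1) single_valuedD[OF M(3)] single_valued_reversal[OF R(1)]
        by (metis neg_equal_iff_equal)
    next
      case False
      then have "(- j, - i) \<in> M" "(- j', - i) \<in> M"
        using ij Mpos(3) R(2) rev(1) by (force simp: A_def)+
      then show ?thesis using M(4) by (force simp: single_valued_def)
    qed
  qed
  then have "single_valued (A\<inverse>)"
    using neg by (auto simp: single_valued_def) (metis add.inverse_inverse)
  then have C: "type_C_arcs n A"
    unfolding type_C_arcs_def using sv neg nz nest by auto
  have dom: "{i \<in> Domain A. 0 < i} = Op"
  proof (intro set_eqI iffI)
    fix i assume "i \<in> {i \<in> Domain A. 0 < i}"
    then obtain j where "(i, j) \<in> A" "0 < i" by blast
    then show "i \<in> Op" using Mpos(1)[of i j] Mpos(4)[of "- j" "- i"] rev(1)[of i "- j"]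
      by (auto simp: A_def R_def)
  next
    fix i assume i: "i \<in> Op"
    show "i \<in> {i \<in> Domain A. 0 < i}"
    proof (cases "i \<in> Domain M")
      case True
      then show ?thesis using i Op(2) by (auto simp: A_def)
    next
      case False
      then obtain k where "(i, k) \<in> reversal R" using i reversal_total[OF R(1)] R_def by blast
      then have "(i, - k) \<in> A" by (simp add: A_def)
      then show ?thesis using i Op(2) by blast
    qed
  qed
  have ran: "{j \<in> Range A. 0 < j} = Cl"
    using M(2) Apos Cl(1) by blast
  have av: "available A j = {x \<in> Op. x < j \<and> \<not> (\<exists>j'<j. (x, j') \<in> M)}" for j
    unfolding available_def using dom Apos Mpos(4) by blast
  have "through A \<subseteq> reversal R" using Athr by (auto simp: through_def)
  then have "antitone (through A)" 
    using antitoneD[OF antitone_reversal[OF R(1)]] unfolding antitone_def by blast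
  then have "greedy sel A" unfolding greedy_def av using Apos gr by blast
  then show ?thesis using C dom ran by blast
qed

text \<open>
  With \<open>Max\<close> and \<open>Min\<close> as \<open>sel\<close> this is the non-crossing and the non-nesting
  case, respectively. All that matters is that the rule selects one of the free openers.
\<close>
lemma unique_greedy_partition:
  fixes sel :: "int set \<Rightarrow> int"
  assumes sel: "\<And>S. finite S \<Longrightarrow> S \<noteq> {} \<Longrightarrow> sel S \<in> S"
    and cfg: "opener_closer_config n Op Cl"
  shows "\<exists>!P. type_C_partition n P \<and> greedy sel (arcs P) \<and> openers P = Op \<and> closers P = Cl"
proof -
  obtain A where A: "type_C_arcs n A" "greedy sel A"
    "{i \<in> Domain A. 0 < i} = Op" "{j \<in> Range A. 0 < j} = Cl"
    using greedy_arcs_exist[OF assms] by blast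
  obtain P where P: "type_C_partition n P" "arcs P = A"
    using ex_type_C_partition_with_arcs[OF A(1) greedy_antitone[OF A(2)]] by blast
  show ?thesis
  proof (rule ex1I[of _ P])
    show "type_C_partition n P \<and> greedy sel (arcs P) \<and> openers P = Op \<and> closers P = Cl"
      using P A by (simp add: openers_eq_Domain_arcs closers_eq_Range_arcs)
  next
    fix Q assume Q: "type_C_partition n Q \<and> greedy sel (arcs Q) \<and> openers Q = Op \<and> closers Q = Cl"
    then have "{i \<in> Domain (arcs Q). 0 < i} = Op" "{j \<in> Range (arcs Q). 0 < j} = Cl"
      using openers_eq_Domain_arcs[of n Q] closers_eq_Range_arcs[of n Q] by simp_all
    then have "arcs Q = A"
      using Q A greedy_arcs_unique[OF type_C_arcs_arcs A(1), of Q sel] by simp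
    then show "Q = P" using type_C_partition_eqI[of n Q P] Q P by simp
  qed
qed

section \<open>Crossings, nestings and greediness\<close>

lemma pair_family_empty_iff:
  "{{(i, j), (i', j')} | i j i' j'. Q i j i' j'} = {} \<longleftrightarrow> \<not> (\<exists>i j i' j'. Q i j i' j')"
  by auto

text \<open>
  Without sets of sets: a crossing may use each of its arcs in either direction.
\<close>
lemma noncrossing_iff:
  "noncrossing P \<longleftrightarrow> \<not> (\<exists>a b a' b'. ((a, b) \<in> arcs P \<or> (b, a) \<in> arcs P) \<and>
     ((a', b') \<in> arcs P \<or> (b', a') \<in> arcs P) \<and>
     cross_less a a' \<and> cross_less a' b \<and> cross_less b b')"
proof -
  have "(\<exists>i j. (i, j) \<in> arcs P \<and> {i, j} = {a, b}) \<longleftrightarrow> (a, b) \<in> arcs P \<or> (b, a) \<in> arcs P" for a b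
    unfolding doubleton_eq_iff by blast
  moreover have "noncrossing P \<longleftrightarrow> \<not> (\<exists>a b a' b'. (\<exists>i j. (i, j) \<in> arcs P \<and> {i, j} = {a, b}) \<and>
     (\<exists>i' j'. (i', j') \<in> arcs P \<and> {i', j'} = {a', b'}) \<and>
     cross_less a a' \<and> cross_less a' b \<and> cross_less b b')"
    unfolding noncrossing_def crossings_def pair_family_empty_iff by meson
  ultimately show ?thesis by simp
qed

text \<open>
  The orientation of the arcs is that of the nesting order, so no arc of a nesting is read
  backwards.
\<close>
lemma nonnesting_iff:
  "nonnesting P \<longleftrightarrow> \<not> (\<exists>a b a' b'. (a, b) \<in> arcs P \<and> (a', b') \<in> arcs P \<and>
     nest_less a a' \<and> nest_less a' b' \<and> nest_less b' b)"
proof -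
  have nest: "nest_less a b \<and> nest_less a a' \<and> nest_less a' b' \<and> nest_less b' b \<longleftrightarrow>
      nest_less a a' \<and> nest_less a' b' \<and> nest_less b' b" for a b a' b'
    using nest_less_trans by blast
  have "(\<exists>i j. (i, j) \<in> arcs P \<and> {i, j} = {a, b}) \<longleftrightarrow> (a, b) \<in> arcs P" if "nest_less a b" for a b
  proof -
    have "(b, a) \<notin> arcs P" using that by (auto simp: arcs_def nest_less_def)
    then show ?thesis unfolding doubleton_eq_iff by blast
  qed
  moreover have "nonnesting P \<longleftrightarrow> \<not> (\<exists>a b a' b'.
     (nest_less a b \<and> nest_less a a' \<and> nest_less a' b' \<and> nest_less b' b) \<and>
     (\<exists>i j. (i, j) \<in> arcs P \<and> {i, j} = {a, b}) \<and> (\<exists>i' j'. (i', j') \<in> arcs P \<and> {i', j'} = {a', b'}))"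
    unfolding nest nonnesting_def nestings_def pair_family_empty_iff by meson
  ultimately have "nonnesting P \<longleftrightarrow> \<not> (\<exists>a b a' b'.
     (nest_less a b \<and> nest_less a a' \<and> nest_less a' b' \<and> nest_less b' b) \<and>
     (a, b) \<in> arcs P \<and> (a', b') \<in> arcs P)"
    by (simp cong: conj_cong)
  then show ?thesis unfolding nest by blast
qed

text \<open>
  A crossing \<open>a < a' < b < b'\<close> involves two arcs, and its shape depends on how
  many of the four points are positive. With four or three positive points, \<open>a'\<close>
  was available to \<open>b\<close> and larger than the chosen \<open>a\<close>; two positive
  points violate order reversal; with one or no positive point, negation gives a configuration
  of the first kind, since it preserves the cyclic crossing order.
\<close>
lemma noncrossing_iff_greedy_Max:
  assumes P: "type_C_partition n P"
  shows "noncrossing P \<longleftrightarrow> greedy Max (arcs P)"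
proof
  let ?A = "arcs P"
  note A = type_C_arcs_arcs[OF P]
  note D = type_C_arcsD[OF A]
  assume nc: "noncrossing P"
  have no: "False" if "(a, b) \<in> ?A" "(a', b') \<in> ?A" "cross_less a a'" "cross_less a' b" "cross_less b b'"
    for a b a' b' using nc that unfolding noncrossing_iff by blast
  have "i = Max (available ?A j)" if ij: "(i, j) \<in> ?A" "0 < j" for i j
  proof (rule Max_eqI[symmetric])
    show "i \<in> available ?A j" using mem_available_if_arc[OF A ij] .
    fix x assume x: "x \<in> available ?A j"
    show "x \<le> i"
    proof (rule ccontr)
      assume "\<not> x \<le> i"
      then have x': "i < x" "0 < i" "x < j" using x nest_less_pos[OF D(3)[OF ij(1)] ij(2)]
        by (auto simp: available_def)
      obtain y where y: "(x, y) \<in> ?A" "\<not> (0 < y \<and> y < j)" using x by (auto simp: available_def)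
      have "y \<noteq> j" using y(1) D(5)[OF ij(1)] x' by blast
      moreover have "y \<noteq> 0" using D(2)[OF y(1)] by (simp add: mem_pm_set)
      ultimately show False using no[OF ij(1) y(1)] x' y(2) by (auto simp: cross_less_def)
    qed
  qed (rule finite_available)
  moreover have "antitone (through ?A)"
    unfolding antitone_def
  proof clarify
    fix i k i' k' assume h: "(i, k) \<in> through ?A" "(i', k') \<in> through ?A" "i < i'"
    then have "k \<noteq> k'" using D(5) by (auto simp: through_def)
    moreover have "\<not> k < k'"
      using no[of i "- k" i' "- k'"] h by (auto simp: through_def cross_less_def)
    ultimately show "k' < k" by linarith
  qed
  ultimately show "greedy Max ?A" by (auto simp: greedy_def)
next
  let ?A = "arcs P"
  note A = type_C_arcs_arcs[OF P]
  note D = type_C_arcsD[OF A]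
  assume gr: "greedy Max ?A"
  \<comment> \<open>An opener better than the chosen one must have been used up by an earlier closer.\<close>
  have key: "0 < y \<and> y < j" if "(i, j) \<in> ?A" "(x, y) \<in> ?A" "0 < i" "i < x" "x < j" for i j x y
  proof (rule ccontr)
    assume "\<not> (0 < y \<and> y < j)"
    moreover have pos: "0 < x" "0 < j" "x < j" using that by linarith+
    ultimately have x: "x \<in> available ?A j"
      using that(2) D(4)[OF that(2)] unfolding available_def by blast
    show False
      using Max_ge[OF finite_available x] greedyD[OF gr that(1) pos(2)] that(4) by linarith
  qed
  show "noncrossing P"
    unfolding noncrossing_iff
  proof clarify
    fix a b a' b'
    assume ab: "(a, b) \<in> ?A \<or> (b, a) \<in> ?A" and ab': "(a', b') \<in> ?A \<or> (b', a') \<in> ?A"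
      and c: "cross_less a a'" "cross_less a' b" "cross_less b b'"
    \<comment> \<open>The crossing order of the end points, together with a sign, fixes the orientation of the arc
      and hence whether the arc itself or its mirror image is to be used.\<close>
    have up: "(x, y) \<in> ?A" if "(x, y) \<in> ?A \<or> (y, x) \<in> ?A" "0 < x" "cross_less x y" for x y
      using that D(3)[of y x] by (auto simp: nest_less_def cross_less_def)
    have down: "(- x, - y) \<in> ?A" if "(x, y) \<in> ?A \<or> (y, x) \<in> ?A" "x < 0" "cross_less x y" for x y
      using that D(3)[of x y] D(6)[of x y] by (auto simp: nest_less_def cross_less_def)
    have c': "cross_less a b" "cross_less a' b'" using c by (auto simp: cross_less_def)
    consider "0 < a" "0 < a'" "0 < b" | "0 < a" "0 < a'" "b < 0" "b' < 0"
      | "0 < a" "a' < 0" "b < 0" "b' < 0" | "a < 0" "a' < 0" "b < 0" "b' < 0"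
      using c by (auto simp: cross_less_def)
    then show False
    proof cases
      case 1
      have "(a, b) \<in> ?A" "(a', b') \<in> ?A" using up ab ab' c' 1 by blast+
      from key[OF this] show False using 1 c by (auto simp: cross_less_def)
    next
      case 2
      have "(a, b) \<in> ?A" "(a', b') \<in> ?A" using up ab ab' c' 2 by blast+
      then have "(a, - b) \<in> through ?A" "(a', - b') \<in> through ?A" using 2 by (auto simp: through_def)
      from antitoneD[OF greedy_antitone[OF gr] this] show False
        using 2 c by (auto simp: cross_less_def)
    next
      case 3
      have "(a, b) \<in> ?A" using up ab c' 3 by blast
      then have "(- b, - a) \<in> ?A" using D(6) by blast
      moreover have "(- a', - b') \<in> ?A" using down ab' c' 3 by blast
      ultimately show False using key[of "- a'" "- b'" "- b" "- a"] 3 c by (auto simp: cross_less_def)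
    next
      case 4
      have "(- a, - b) \<in> ?A" "(- a', - b') \<in> ?A" using down ab ab' c' 4 by blast+
      from key[OF this] show False using 4 c by (auto simp: cross_less_def)
    qed
  qed
qed

text \<open>
  In a nesting \<open>a < a' < b' < b\<close> with \<open>b'\<close> positive, \<open>a\<close>
  was available to \<open>b'\<close> and smaller than the chosen \<open>a'\<close>. If
  \<open>a'\<close> is negative, then negation, which reverses the nesting order, leads back to
  this case; in the remaining case both arcs go from positive to negative elements, and order
  reversal is violated.
\<close>
lemma nonnesting_iff_greedy_Min:
  assumes P: "type_C_partition n P"
  shows "nonnesting P \<longleftrightarrow> greedy Min (arcs P)"
proof
  let ?A = "arcs P"
  note A = type_C_arcs_arcs[OF P]
  note D = type_C_arcsD[OF A]
  assume nn: "nonnesting P"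
  have no: "False" if "(a, b) \<in> ?A" "(a', b') \<in> ?A" "nest_less a a'" "nest_less b' b"
    for a b a' b' using nn that D(3)[OF that(2)] unfolding nonnesting_iff by blast
  have "i = Min (available ?A j)" if ij: "(i, j) \<in> ?A" "0 < j" for i j
  proof (rule Min_eqI[symmetric])
    show "i \<in> available ?A j" using mem_available_if_arc[OF A ij] .
    fix x assume x: "x \<in> available ?A j"
    show "i \<le> x"
    proof (rule ccontr)
      assume "\<not> i \<le> x"
      then have x': "x < i" "0 < x" "i < j" using x nest_less_pos[OF D(3)[OF ij(1)] ij(2)]
        by (auto simp: available_def)
      obtain y where y: "(x, y) \<in> ?A" "\<not> (0 < y \<and> y < j)" using x by (auto simp: available_def)
      have "y \<noteq> j" using y(1) D(5)[OF ij(1)] x' by blast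
      moreover have "y \<noteq> 0" using D(2)[OF y(1)] by (simp add: mem_pm_set)
      ultimately show False using no[OF y(1) ij(1)] x' y(2) by (auto simp: nest_less_def)
    qed
  qed (rule finite_available)
  moreover have "antitone (through ?A)"
    unfolding antitone_def
  proof clarify
    fix i k i' k' assume h: "(i, k) \<in> through ?A" "(i', k') \<in> through ?A" "i < i'"
    then have "k \<noteq> k'" using D(5) by (auto simp: through_def)
    moreover have "\<not> k < k'"
      using no[of i "- k" i' "- k'"] h by (auto simp: through_def nest_less_def)
    ultimately show "k' < k" by linarith
  qed
  ultimately show "greedy Min ?A" by (auto simp: greedy_def)
next
  let ?A = "arcs P"
  note A = type_C_arcs_arcs[OF P]
  note D = type_C_arcsD[OF A]
  assume gr: "greedy Min ?A"
  \<comment> \<open>An opener better than the chosen one must have been used up by an earlier closer.\<close>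
  have key: "0 < y \<and> y < j" if "(i, j) \<in> ?A" "(x, y) \<in> ?A" "0 < x" "x < i" "i < j" for i j x y
  proof (rule ccontr)
    assume "\<not> (0 < y \<and> y < j)"
    moreover have pos: "0 < x" "0 < j" "x < j" using that by linarith+
    ultimately have x: "x \<in> available ?A j"
      using that(2) D(4)[OF that(2)] unfolding available_def by blast
    show False
      using Min_le[OF finite_available x] greedyD[OF gr that(1) pos(2)] that(4) by linarith
  qed
  show "nonnesting P"
    unfolding nonnesting_iff
  proof clarify
    fix a b a' b'
    assume ab: "(a, b) \<in> ?A" and ab': "(a', b') \<in> ?A"
      and c: "nest_less a a'" "nest_less a' b'" "nest_less b' b"
    have neg: "(- b, - a) \<in> ?A" "(- b', - a') \<in> ?A" using ab ab' D(6) by blast+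
    consider "0 < a" "0 < a'" "0 < b'" | "0 < a" "0 < a'" "b' < 0" "b < 0"
      | "a' < 0" "b' < 0" "b < 0"
      using c by (auto simp: nest_less_def)
    then show False
    proof cases
      case 1
      from key[OF ab' ab] show False using 1 c by (auto simp: nest_less_def)
    next
      case 2
      then have "(a, - b) \<in> through ?A" "(a', - b') \<in> through ?A"
        using ab ab' by (auto simp: through_def)
      from antitoneD[OF greedy_antitone[OF gr] this] show False
        using 2 c by (auto simp: nest_less_def)
    next
      case 3
      from key[OF neg(2) neg(1)] show False using 3 c by (auto simp: nest_less_def)
    qed
  qed
qed

theorem corollary3p2:
  fixes n :: nat and Op Cl :: "int set"
  assumes "n \<ge> 1"
    and "opener_closer_config n Op Cl"
  shows "(\<exists>!B. type_C_partition n B \<and> noncrossing B \<and> openers B = Op \<and> closers B = Cl) \<and>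
         (\<exists>!B'. type_C_partition n B' \<and> nonnesting B' \<and> openers B' = Op \<and> closers B' = Cl)"
proof -
  have "\<exists>!P. type_C_partition n P \<and> greedy Max (arcs P) \<and> openers P = Op \<and> closers P = Cl"
    "\<exists>!P. type_C_partition n P \<and> greedy Min (arcs P) \<and> openers P = Op \<and> closers P = Cl"
    using assms(2) by (auto intro!: unique_greedy_partition Max_in Min_in)
  then show ?thesis
    using noncrossing_iff_greedy_Max nonnesting_iff_greedy_Min by (simp cong: conj_cong)
qed

end
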